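(* Let $S_1,S_2\subset\mathbb{R}$ contain all terms of lacunary sequences $(b_i)_{i\ge1}$ and $(d_j)_{j\ge1}$ in $(0,\infty)$, respectively, such that either (i) $-\log b_i=o(i^{\alpha})$ and $-\log d_j=o(j^{\beta})$ for some $\alpha,\beta>1$ with $\frac1\alpha+\frac1\beta\ge1$; or (ii) $-\log b_i=O(i^{\alpha})$ and $-\log d_j=O(j^{\beta})$ for some $\alpha,\beta\ge1$ with $\frac1\alpha+\frac1\beta>1$. Then $S_1+S_2$ and $S_1-S_2$ are not measure universal.
   Context: A set $E\subset\mathbb{R}$ is measure universal if for every Lebesgue measurable $L\subset\mathbb{R}$ of positive Lebesgue measure there exist $x\in\mathbb{R}$ and $\lambda\neq0$ with $x+\lambda E\subset L$. A sequence $(b_i)_{i\ge1}\subset(0,\infty)$ is lacunary with ratio $q\in(0,1)$ if $b_{i+1}\le q\,b_i$ for all $i$; it is lacunary if this holds for some $q\in(0,1)$ (the two sequences may have different ratios). $S_1\pm S_2=\{s_1\pm s_2: s_1\in S_1,\ s_2\in S_2\}$. *)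

theory Defs
  imports "HOL-Analysis.Analysis" "HOL-Library.Landau_Symbols"
begin

definition measure_universal :: "real set \<Rightarrow> bool" where
  "measure_universal E \<longleftrightarrow>
     (\<forall>L \<in> sets lebesgue. emeasure lebesgue L > 0 \<longrightarrow>
        (\<exists>x c :: real. c \<noteq> 0 \<and> (\<lambda>e. x + c * e) ` E \<subseteq> L))"

(* Sequences are indexed from 1; the value at index 0 is ignored. *)
definition lacunary_with_ratio :: "(nat \<Rightarrow> real) \<Rightarrow> real \<Rightarrow> bool" where
  "lacunary_with_ratio b q \<longleftrightarrow>
     0 < q \<and> q < 1 \<and> (\<forall>i\<ge>1. 0 < b i) \<and> (\<forall>i\<ge>1. b (i + 1) \<le> q * b i)"

definition lacunary :: "(nat \<Rightarrow> real) \<Rightarrow> bool" where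
  "lacunary b \<longleftrightarrow> (\<exists>q. lacunary_with_ratio b q)"

(* Not the type-class minus, which on sets is set difference. *)
definition sumset :: "real set \<Rightarrow> real set \<Rightarrow> real set" where
  "sumset S T = {s + t | s t. s \<in> S \<and> t \<in> T}"

definition diffset :: "real set \<Rightarrow> real set \<Rightarrow> real set" where
  "diffset S T = {s - t | s t. s \<in> S \<and> t \<in> T}"

end

theory Submission
  imports Defs "HOL-Real_Asymp.Real_Asymp"
begin

text \<open>An $n$-point set whose gaps are at least $1/N$ meets $n$ different cells of length $1/N$ under
  every affine map $x + c\,\cdot$ with $1 \le c \le 2$. Up to an error of one cell there are only
  polynomially many such maps (in $N$), so when $\log N = o(n)$ a greedily chosen set of
  $\varepsilon N$ cells hits all these patterns; deleting it from the unit interval, once for each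
  rational scale, leaves a set of positive measure without affine copies.

  The sums $b_i \pm d_j$ may be arbitrarily close to each other. Except for boundedly many $j$ for each
  $i$, however, one of $b_i$, $d_j$ is much smaller than the other, and the sums in which the same sequence
  dominates have gaps comparable to the smallest term. With $i \le T^{1/\alpha}$ and
  $j \le T^{1/\beta}$ this yields about $T^{1/\alpha + 1/\beta}$ points with gaps
  at least $e^{-o(T^{1/\alpha + 1/\beta})}$.\<close>

section \<open>Hitting all affine copies of one finite separated set\<close>

text \<open>Double counting of incidences shows that some point of \<open>U\<close> lies in at least
  a fraction \<open>n / card U\<close> of the sets not yet hit. Adding this point to
  \<open>R\<close> multiplies the number of unhit sets by at most \<open>1 - n / card U\<close>,
  which is at most \<open>exp (- n / card U)\<close>; the factors accumulate over \<open>r\<close>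
  rounds.\<close>

lemma greedy_hitting_set:
  fixes T :: "'i \<Rightarrow> 'a set" and n r :: nat
  assumes U: "finite U" "U \<noteq> {}" and I: "finite I"
    and T: "\<And>i. i \<in> I \<Longrightarrow> T i \<subseteq> U" "\<And>i. i \<in> I \<Longrightarrow> n \<le> card (T i)"
  shows "\<exists>R\<subseteq>U. card R \<le> r \<and>
    real (card {i\<in>I. T i \<inter> R = {}}) \<le> real (card I) * exp (- (real n * real r / real (card U)))"
proof (induction r)
  case 0
  show ?case by (rule exI[of _ "{}"]) auto
next
  case (Suc r)
  then obtain R where R: "R \<subseteq> U" "card R \<le> r"
    and bound: "real (card {i\<in>I. T i \<inter> R = {}}) \<le> real (card I) * exp (- (real n * real r / real (card U)))"
    by blast
  define J where "J = {i\<in>I. T i \<inter> R = {}}"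
  have finJ: "finite J" using I by (auto simp: J_def)
  have finR: "finite R" using R U finite_subset by blast
  have u: "real (card U) > 0" using U by (simp add: card_gt_0_iff)
  have "\<exists>x\<in>U. real n * real (card J) \<le> real (card U) * real (card {i\<in>J. x \<in> T i})"
  proof (rule ccontr)
    assume "\<not> ?thesis"
    hence less: "\<And>x. x \<in> U \<Longrightarrow> real (card U) * real (card {i\<in>J. x \<in> T i}) < real n * real (card J)"
      by force
    have "(\<Sum>x\<in>U. real (card U) * real (card {i\<in>J. x \<in> T i})) < (\<Sum>x\<in>U. real n * real (card J))"
      using U less by (intro sum_strict_mono) auto
    also have "\<dots> = real (card U) * (real n * real (card J))" by simp
    finally have "(\<Sum>x\<in>U. real (card {i\<in>J. x \<in> T i})) < real n * real (card J)"
      using u by (simp add: sum_distrib_left[symmetric])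
    moreover have "(\<Sum>x\<in>U. card {i\<in>J. x \<in> T i}) = (\<Sum>i\<in>J. card {x\<in>U. x \<in> T i})"
      using sum.swap_restrict[of U J "\<lambda>_ _. 1::nat" "\<lambda>x i. x \<in> T i"] U finJ by simp
    moreover have "(\<Sum>i\<in>J. card {x\<in>U. x \<in> T i}) \<ge> (\<Sum>i\<in>J. n)"
    proof (rule sum_mono)
      fix i assume "i \<in> J"
      hence "i \<in> I" by (simp add: J_def)
      hence "{x\<in>U. x \<in> T i} = T i" using T(1) by blast
      thus "n \<le> card {x\<in>U. x \<in> T i}" using T(2) \<open>i \<in> I\<close> by simp
    qed
    ultimately have "real (card J * n) < real n * real (card J)"
      by (simp only: of_nat_sum[symmetric] sum_constant of_nat_id)
    thus False by simp
  qed
  then obtain x where x: "x \<in> U"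
    "real n * real (card J) \<le> real (card U) * real (card {i\<in>J. x \<in> T i})" by blast
  have "{i\<in>I. T i \<inter> insert x R = {}} = J - {i\<in>J. x \<in> T i}" by (auto simp: J_def)
  hence "real (card {i\<in>I. T i \<inter> insert x R = {}}) = real (card J) - real (card {i\<in>J. x \<in> T i})"
    using finJ by (simp add: card_Diff_subset card_mono of_nat_diff)
  also have "\<dots> \<le> real (card J) * (1 - real n / real (card U))"
    using x(2) u by (simp add: field_simps)
  also have "\<dots> \<le> real (card J) * exp (- (real n / real (card U)))"
    using exp_ge_add_one_self[of "- (real n / real (card U))"] by (intro mult_left_mono) auto
  also have "\<dots> \<le> (real (card I) * exp (- (real n * real r / real (card U)))) * exp (- (real n / real (card U)))"
    using bound by (intro mult_right_mono) (auto simp: J_def)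
  also have "\<dots> = real (card I) * exp (- (real n * real (Suc r) / real (card U)))"
    using u by (simp add: exp_add[symmetric] field_simps)
  finally show ?case
    using x(1) R finR by (intro exI[of _ "insert x R"]) (auto simp: card_insert_if)
qed


text \<open>The maps are discretized on a grid of mesh \<open>h\<close>, and each discretized copy
  of \<open>P\<close> occupies \<open>card P\<close> distinct cells of length \<open>1 / N\<close>.
  The hypothesis \<open>big\<close> says that the squared polynomial bound on the number of grid
  maps is beaten by the exponential gain of the greedy choice, so that fewer than one copy, hence
  none, is left unhit.\<close>

lemma avoid_separated_set:
  fixes P :: "real set" and K N :: nat and \<epsilon> :: real
  assumes P: "finite P" "P \<noteq> {}" and K: "K \<ge> 1" "\<And>p. p \<in> P \<Longrightarrow> \<bar>p\<bar> \<le> real K"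
    and sep: "\<And>p p'. p \<in> P \<Longrightarrow> p' \<in> P \<Longrightarrow> p \<noteq> p' \<Longrightarrow> 1 \<le> real N * \<bar>p - p'\<bar>"
    and \<epsilon>: "\<epsilon> > 0" "real N * \<epsilon> \<ge> 6" and N: "N \<ge> 1"
    and big: "2 * ln (21 * real K ^ 2 * real N) < \<epsilon> / 24 * real (card P)"
  shows "\<exists>B\<in>sets lebesgue. emeasure lebesgue B \<le> ennreal \<epsilon> \<and>
    (\<forall>x c. 1 \<le> c \<and> c \<le> 2 \<longrightarrow> (\<exists>p\<in>P. x + c * p \<notin> {0..1} - B))"
proof -
  \<comment> \<open>With this mesh, rounding both \<open>x\<close> and \<open>c\<close> displaces a
    point \<open>x + c * p\<close> by at most \<open>h + h * K\<close>, which is at most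
    \<open>1 / N\<close>.\<close>
  define h where "h = 1 / (2 * real K * real N)"
  have h: "h > 0" using K N by (simp add: h_def)
  \<comment> \<open>\<open>Q\<close> bounds both grid indices. If a copy lies in the unit interval,
    then \<open>x\<close> is at most \<open>3 * K\<close> in absolute value, so its index is at most
    \<open>6 * K^2 * N\<close> plus one for rounding; the index of \<open>c\<close> is
    smaller.\<close>
  define Q where "Q = int (7 * K\<^sup>2 * N)"
  define pt where "pt = (\<lambda>(a::int, l::int) p. h * of_int a + h * of_int l * p)"
  \<comment> \<open>A scale of at least 1 preserves the separation of \<open>P\<close>. The window
    from -1 to 2 is the unit interval with room for the rounding error \<open>1 / N\<close>.\<close>
  define I where "I = {al \<in> {-Q..Q} \<times> {-Q..Q}. h * of_int (snd al) \<ge> 1 \<and> (\<forall>p\<in>P. pt al p \<in> {-1..2})}"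
  define T where "T al = (\<lambda>p. \<lfloor>real N * pt al p\<rfloor>) ` P" for al
  define U where "U = {- int N..2 * int N}"
  \<comment> \<open>The divisor 3 is there because each chosen cell will be removed together with
    its two neighbours, at a cost of \<open>3 / N\<close>.\<close>
  define r where "r = nat \<lfloor>\<epsilon> * real N / 3\<rfloor>"
  have finI: "finite I" by (simp add: I_def)
  have "0 < 7 * K\<^sup>2 * N" using K N by simp
  hence Q1: "Q \<ge> 1" unfolding Q_def by linarith
  have "card I \<le> card ({-Q..Q} \<times> {-Q..Q})"
    by (rule card_mono) (auto simp: I_def)
  also have "\<dots> = nat (2 * Q + 1) ^ 2" by (simp add: power2_eq_square)
  finally have "real (card I) \<le> real (nat (2 * Q + 1) ^ 2)" by linarith
  also have "\<dots> = (2 * real_of_int Q + 1) ^ 2" using Q1 by simp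
  also have "\<dots> \<le> (3 * real_of_int Q) ^ 2" using Q1 by (intro power_mono) auto
  also have "\<dots> = (21 * real K ^ 2 * real N) ^ 2" by (simp add: Q_def power_mult_distrib)
  finally have cardI: "real (card I) \<le> (21 * real K ^ 2 * real N) ^ 2" .
  \<comment> \<open>After multiplication by \<open>N\<close> and by a scale of at least 1, distinct
    points of \<open>P\<close> are at distance at least 1, so their floors differ.\<close>
  have cardT: "card (T al) = card P" if "al \<in> I" for al
  proof -
    obtain a l where al: "al = (a, l)" by (cases al)
    have l1: "h * of_int l \<ge> 1" using that by (simp add: I_def al)
    have "inj_on (\<lambda>p. \<lfloor>real N * pt al p\<rfloor>) P"
    proof (rule inj_onI, rule ccontr)
      fix p p' assume p: "p \<in> P" "p' \<in> P" "\<lfloor>real N * pt al p\<rfloor> = \<lfloor>real N * pt al p'\<rfloor>" "p \<noteq> p'"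
      have "\<bar>real N * pt al p - real N * pt al p'\<bar> < 1" using p(3) by linarith
      moreover have "real N * pt al p - real N * pt al p' = (h * of_int l) * (real N * (p - p'))"
        by (simp add: pt_def al algebra_simps)
      moreover have "\<bar>(h * of_int l) * (real N * (p - p'))\<bar> \<ge> 1 * 1"
        unfolding abs_mult[of "h * of_int l"]
      proof (rule mult_mono)
        show "1 \<le> \<bar>h * of_int l\<bar>" using l1 by linarith
        show "1 \<le> \<bar>real N * (p - p')\<bar>" using sep[OF p(1,2,4)] by (simp add: abs_mult)
      qed auto
      ultimately show False by linarith
    qed
    thus ?thesis unfolding T_def by (rule card_image)
  qed
  have TU: "T al \<subseteq> U" if "al \<in> I" for al
  proof
    fix m assume "m \<in> T al"
    then obtain p where p: "p \<in> P" "m = \<lfloor>real N * pt al p\<rfloor>" by (auto simp: T_def)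
    have pp: "-1 \<le> pt al p" "pt al p \<le> 2" using that p by (auto simp: I_def)
    have "real N * (-1) \<le> real N * pt al p" "real N * pt al p \<le> real N * 2"
      using pp by (intro mult_left_mono; simp)+
    thus "m \<in> U" unfolding U_def p(2) by simp linarith
  qed
  have "\<exists>R\<subseteq>U. card R \<le> r \<and>
    real (card {i\<in>I. T i \<inter> R = {}}) \<le> real (card I) * exp (- (real (card P) * real r / real (card U)))"
    using cardT TU finI by (intro greedy_hitting_set) (auto simp: U_def)
  then obtain R where R: "R \<subseteq> U" "card R \<le> r" and
    hit: "real (card {i\<in>I. T i \<inter> R = {}}) \<le> real (card I) * exp (- (real (card P) * real r / real (card U)))"
    by blast
  have finR: "finite R" using R(1) by (rule finite_subset) (simp add: U_def)
  \<comment> \<open>Taking the floor loses at most half, because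
    \<open>real N * \<epsilon> / 3\<close> is at least 2.\<close>
  have r1: "real r \<ge> \<epsilon> * real N / 6" using \<epsilon>(2) unfolding r_def by (simp add: mult.commute) linarith
  have r2: "real r \<le> \<epsilon> * real N / 3" using \<epsilon> unfolding r_def by simp linarith
  have cU: "real (card U) \<le> 4 * real N" "real (card U) > 0" using N by (auto simp: U_def)
  have "\<epsilon> / 24 \<le> real r / real (card U)"
  proof -
    have "\<epsilon> / 24 = (\<epsilon> * real N / 6) / (4 * real N)" using N by simp
    also have "\<dots> \<le> real r / real (card U)" using r1 cU by (intro frac_le) auto
    finally show ?thesis .
  qed
  hence "\<epsilon> / 24 * real (card P) \<le> real r / real (card U) * real (card P)"
    by (rule mult_right_mono) simp
  also have "\<dots> = real (card P) * real r / real (card U)" by simp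
  finally have big2: "2 * ln (21 * real K ^ 2 * real N) < real (card P) * real r / real (card U)"
    using big by linarith
  have KN: "21 * real K ^ 2 * real N > 0" using K N by simp
  have "(21 * real K ^ 2 * real N) ^ 2 = exp (2 * ln (21 * real K ^ 2 * real N))"
    using KN by (simp add: exp_double)
  also have "\<dots> < exp (real (card P) * real r / real (card U))" using big2 by simp
  finally have "real (card I) < exp (real (card P) * real r / real (card U))" using cardI by linarith
  hence "real (card I) * exp (- (real (card P) * real r / real (card U))) < 1"
    by (simp add: exp_minus field_simps)
  hence "card {i\<in>I. T i \<inter> R = {}} = 0" using hit by linarith
  hence "{i\<in>I. T i \<inter> R = {}} = {}" using finI by (subst (asm) card_0_eq) auto
  hence hitall: "T i \<inter> R \<noteq> {}" if "i \<in> I" for i using that by blast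
  \<comment> \<open>Each cell is enlarged by one cell on either side, so that hitting the rounded
    copy forces the original copy to meet \<open>B\<close>.\<close>
  define B where "B = (\<Union>m\<in>R. {(of_int m - 1) / real N..(of_int m + 2) / real N})"
  have Bs: "B \<in> sets lebesgue" unfolding B_def using finR by (intro sets.finite_UN) auto
  have "emeasure lebesgue B \<le> (\<Sum>m\<in>R. emeasure lebesgue {(of_int m - 1) / real N..(of_int m + 2) / real N})"
    unfolding B_def using finR by (intro emeasure_subadditive_finite) auto
  also have "\<dots> = (\<Sum>m\<in>R. ennreal (3 / real N))"
    using N by (intro sum.cong) (auto simp: divide_right_mono diff_divide_distrib[symmetric])
  also have "\<dots> = ennreal (real (card R) * (3 / real N))" 
    by (simp add: ennreal_of_nat_eq_real_of_nat flip: ennreal_mult')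
  also have "\<dots> \<le> ennreal \<epsilon>"
  proof (rule ennreal_leI)
    have "real (card R) * (3 / real N) \<le> (\<epsilon> * real N / 3) * (3 / real N)"
      using r2 R(2) by (intro mult_right_mono) auto
    thus "real (card R) * (3 / real N) \<le> \<epsilon>" using N by simp
  qed
  finally have Bm: "emeasure lebesgue B \<le> ennreal \<epsilon>" .
  have "\<exists>p\<in>P. x + c * p \<notin> {0..1} - B" if c: "1 \<le> c" "c \<le> 2" for x c
  proof (rule ccontr)
    assume "\<not> ?thesis"
    hence inL: "\<And>p. p \<in> P \<Longrightarrow> 0 \<le> x + c * p \<and> x + c * p \<le> 1 \<and> x + c * p \<notin> B" by auto
    define a where "a = \<lfloor>x / h\<rfloor>"
    \<comment> \<open>Rounding up, unlike the rounding of \<open>x\<close>, keeps the discretized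
      scale at least \<open>c\<close> and hence at least 1, as membership in \<open>I\<close>
      demands.\<close>
    define l where "l = \<lceil>c / h\<rceil>"
    have a: "h * of_int a \<le> x" "x \<le> h * of_int a + h"
    proof -
      have "of_int a \<le> x / h" "x / h \<le> of_int a + 1" unfolding a_def by linarith+
      thus "h * of_int a \<le> x" "x \<le> h * of_int a + h" using h by (simp_all add: field_simps)
    qed
    have l: "c \<le> h * of_int l" "h * of_int l \<le> c + h"
    proof -
      have "c / h \<le> of_int l" "of_int l \<le> c / h + 1" unfolding l_def by linarith+
      thus "c \<le> h * of_int l" "h * of_int l \<le> c + h" using h by (simp_all add: field_simps)
    qed
    have near: "\<bar>pt (a, l) p - (x + c * p)\<bar> \<le> 1 / real N" if "p \<in> P" for p
    proof -
      have "\<bar>pt (a, l) p - (x + c * p)\<bar> = \<bar>(h * of_int a - x) + (h * of_int l - c) * p\<bar>"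
        by (simp add: pt_def algebra_simps)
      also have "\<dots> \<le> \<bar>h * of_int a - x\<bar> + \<bar>h * of_int l - c\<bar> * \<bar>p\<bar>"
        by (metis abs_mult abs_triangle_ineq)
      also have "\<dots> \<le> h + h * real K"
        using a l K(2)[OF that] h by (intro add_mono mult_mono) auto
      also have "\<dots> \<le> h * real K + h * real K" using K h by simp
      also have "\<dots> = 1 / real N" using K N by (simp add: h_def field_simps)
      finally show ?thesis .
    qed
    obtain p0 where p0: "p0 \<in> P" using P by auto
    have cp: "\<bar>c * p0\<bar> \<le> 2 * real K" unfolding abs_mult using c K(2)[OF p0] by (intro mult_mono) auto
    hence x: "\<bar>x\<bar> \<le> 3 * real K" using inL[OF p0] K(1) by linarith
    have hinv: "1 / h = 2 * real K * real N" by (simp add: h_def)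
    have KN1: "real K * real N \<le> real K ^ 2 * real N" "1 \<le> real K * real N"
    proof -
      have "real K * 1 \<le> real K * real K" using K by (intro mult_left_mono) auto
      thus "real K * real N \<le> real K ^ 2 * real N" by (simp add: power2_eq_square mult_right_mono)
      have "1 \<le> K * N" using K N by simp
      thus "1 \<le> real K * real N" by (metis of_nat_1 of_nat_le_iff of_nat_mult)
    qed
    have "\<bar>x / h\<bar> = \<bar>x\<bar> * (1 / h)" using h by simp
    also have "\<dots> \<le> 3 * real K * (2 * real K * real N)"
      unfolding hinv using x by (intro mult_right_mono) auto
    also have "\<dots> = 6 * (real K ^ 2 * real N)" by (simp add: power2_eq_square)
    finally have "\<bar>real_of_int a\<bar> \<le> 6 * (real K ^ 2 * real N) + 1"
      unfolding a_def by linarith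
    also have "\<dots> \<le> 7 * (real K ^ 2 * real N)" using KN1 by linarith
    finally have "\<bar>real_of_int a\<bar> \<le> real_of_int Q" by (simp add: Q_def)
    hence aQ: "a \<in> {-Q..Q}" by auto
    have "c / h = c * (1 / h)" by simp
    also have "\<dots> \<le> 2 * (2 * real K * real N)"
      unfolding hinv using c by (intro mult_right_mono) auto
    finally have "real_of_int l \<le> 4 * (real K * real N) + 1" unfolding l_def by linarith
    also have "\<dots> \<le> 7 * (real K ^ 2 * real N)" using KN1 by linarith
    finally have "real_of_int l \<le> real_of_int Q" by (simp add: Q_def)
    hence "l \<le> Q" by simp
    moreover have "l \<ge> 0"
    proof -
      have "0 < c / h" using h c by simp
      thus ?thesis unfolding l_def by linarith
    qed
    ultimately have lQ: "l \<in> {-Q..Q}" using Q1 by auto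
    have N1: "1 / real N \<le> 1" using N by simp
    have "(a, l) \<in> I"
      using aQ lQ l c near inL N1 unfolding I_def by fastforce
    then obtain m where m: "m \<in> T (a, l)" "m \<in> R" using hitall by blast
    then obtain p where p: "p \<in> P" "m = \<lfloor>real N * pt (a, l) p\<rfloor>" by (auto simp: T_def)
    have "of_int m \<le> real N * pt (a, l) p" "real N * pt (a, l) p \<le> of_int m + 1"
      unfolding p(2) by linarith+
    moreover have "\<bar>real N * pt (a, l) p - real N * (x + c * p)\<bar> \<le> 1"
      using mult_left_mono[OF near[OF p(1)], of "real N"] N
      by (simp add: abs_mult[of "real N", simplified, symmetric] right_diff_distrib)
    ultimately have "of_int m - 1 \<le> real N * (x + c * p)" "real N * (x + c * p) \<le> of_int m + 2"
      by linarith+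
    hence "x + c * p \<in> {(of_int m - 1) / real N..(of_int m + 2) / real N}"
      using N by (simp add: field_simps)
    hence "x + c * p \<in> B" using m(2) unfolding B_def by blast
    thus False using inL[OF p(1)] by simp
  qed
  thus ?thesis using Bs Bm by blast
qed

section \<open>Rich sets are not measure universal\<close>

text \<open>In the literature this richness condition is phrased as $-\log\delta_n = o(n)$ for the minimal
  gap $\delta_n$ of some $n$-point subset; here $N$ plays the role of $1/\delta_n$.\<close>

definition sep_rich :: "real set \<Rightarrow> bool" where
  "sep_rich A \<longleftrightarrow> (\<exists>K::real. \<forall>\<eta>>0. \<exists>P\<subseteq>A. \<exists>N::nat.
     finite P \<and> (\<forall>p\<in>P. \<bar>p\<bar> \<le> K) \<and>
     (\<forall>p\<in>P. \<forall>p'\<in>P. p \<noteq> p' \<longrightarrow> 1 \<le> real N * \<bar>p - p'\<bar>) \<and>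
     1 / \<eta> \<le> real N \<and> ln (real N) \<le> \<eta> * real (card P))"

text \<open>Scaling multiplies the gaps by the absolute value of \<open>c\<close>, which is
  compensated by replacing \<open>N\<close> with \<open>N * m\<close> for a fixed \<open>m\<close>.
  The extra \<open>ln m\<close> is at most \<open>ln N\<close> once \<open>N\<close> is at least
  \<open>m\<close>.\<close>

lemma sep_rich_scale:
  assumes "sep_rich A" and c: "c \<noteq> 0"
  shows "sep_rich ((\<lambda>a. c * a) ` A)"
proof -
  obtain K where K: "\<And>\<eta>. \<eta> > 0 \<Longrightarrow> \<exists>P\<subseteq>A. \<exists>N::nat.
     finite P \<and> (\<forall>p\<in>P. \<bar>p\<bar> \<le> K) \<and>
     (\<forall>p\<in>P. \<forall>p'\<in>P. p \<noteq> p' \<longrightarrow> 1 \<le> real N * \<bar>p - p'\<bar>) \<and>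
     1 / \<eta> \<le> real N \<and> ln (real N) \<le> \<eta> * real (card P)"
    using assms(1) unfolding sep_rich_def by blast
  define m where "m = nat \<lceil>1 / \<bar>c\<bar>\<rceil>"
  have m: "1 / \<bar>c\<bar> \<le> real m" unfolding m_def by linarith
  have m0: "real m > 0" using m c by (smt (verit) zero_less_abs_iff divide_pos_pos)
  have mc: "1 \<le> real m * \<bar>c\<bar>" using m c by (simp add: divide_le_eq)
  show ?thesis unfolding sep_rich_def
  proof (intro exI[of _ "\<bar>c\<bar> * K"] allI impI)
    fix \<eta> :: real assume \<eta>: "\<eta> > 0"
    \<comment> \<open>The first entry pays for the doubled logarithm, the second forces
      \<open>N\<close> to be at least \<open>m\<close>.\<close>
    define \<eta>' where "\<eta>' = min (\<eta> / 2) (1 / real m)"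
    have \<eta>': "\<eta>' > 0" "\<eta>' \<le> \<eta> / 2" "\<eta>' \<le> 1 / real m" using \<eta> m0 by (auto simp: \<eta>'_def)
    obtain P and N :: nat where P: "P \<subseteq> A" "finite P" "\<forall>p\<in>P. \<bar>p\<bar> \<le> K"
      "\<forall>p\<in>P. \<forall>p'\<in>P. p \<noteq> p' \<longrightarrow> 1 \<le> real N * \<bar>p - p'\<bar>"
      "1 / \<eta>' \<le> real N" "ln (real N) \<le> \<eta>' * real (card P)"
      using K[OF \<eta>'(1)] by blast
    have "real m \<le> 1 / \<eta>'" using \<eta>' m0 by (simp add: field_simps)
    hence mN: "real m \<le> real N" using P(5) by linarith
    have N0: "real N > 0" using mN m0 by linarith
    have "1 / \<eta> \<le> 1 / \<eta>'" using \<eta>' \<eta> by (intro divide_left_mono) auto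
    also have "\<dots> \<le> real N * 1" using P(5) by simp
    also have "\<dots> \<le> real N * real m" using m0 N0 by (intro mult_left_mono) auto
    finally have 1: "1 / \<eta> \<le> real (N * m)" by simp
    have "ln (real (N * m)) = ln (real N) + ln (real m)" using N0 m0 by (simp add: ln_mult)
    also have "ln (real m) \<le> ln (real N)" using mN m0 by simp
    also have "ln (real N) + ln (real N) \<le> 2 * (\<eta>' * real (card P))" using P(6) by simp
    also have "\<dots> \<le> 2 * (\<eta> / 2 * real (card P))"
      using \<eta>' by (intro mult_left_mono mult_right_mono) auto
    also have "card P = card ((\<lambda>a. c * a) ` P)"
      using c by (intro card_image[symmetric]) (auto intro!: inj_onI)
    finally have 2: "ln (real (N * m)) \<le> \<eta> * real (card ((\<lambda>a. c * a) ` P))" by simp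
    have 3: "1 \<le> real (N * m) * \<bar>c * p - c * p'\<bar>" if "p \<in> P" "p' \<in> P" "p \<noteq> p'" for p p'
    proof -
      have "1 * 1 \<le> (real N * \<bar>p - p'\<bar>) * (real m * \<bar>c\<bar>)"
        using P(4) that mc by (intro mult_mono) auto
      also have "\<dots> = real (N * m) * \<bar>c * p - c * p'\<bar>"
        by (simp add: right_diff_distrib[symmetric] abs_mult)
      finally show ?thesis by simp
    qed
    show "\<exists>P'\<subseteq>(\<lambda>a. c * a) ` A. \<exists>N::nat. finite P' \<and> (\<forall>p\<in>P'. \<bar>p\<bar> \<le> \<bar>c\<bar> * K) \<and>
       (\<forall>p\<in>P'. \<forall>p'\<in>P'. p \<noteq> p' \<longrightarrow> 1 \<le> real N * \<bar>p - p'\<bar>) \<and>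
       1 / \<eta> \<le> real N \<and> ln (real N) \<le> \<eta> * real (card P')"
      using P(1-3) 1 2 3
      by (intro exI[of _ "(\<lambda>a. c * a) ` P"] conjI exI[of _ "N * m"])
        (auto simp: abs_mult mult_left_mono)
  qed
qed

lemma sep_rich_avoid:
  assumes "sep_rich A" and \<epsilon>: "\<epsilon> > 0"
  shows "\<exists>B\<in>sets lebesgue. emeasure lebesgue B \<le> ennreal \<epsilon> \<and>
    (\<forall>x c. 1 \<le> c \<and> c \<le> 2 \<longrightarrow> (\<exists>p\<in>A. x + c * p \<notin> {0..1} - B))"
proof -
  obtain K' :: real where K': "\<And>\<eta>. \<eta> > 0 \<Longrightarrow> \<exists>P\<subseteq>A. \<exists>N::nat.
     finite P \<and> (\<forall>p\<in>P. \<bar>p\<bar> \<le> K') \<and>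
     (\<forall>p\<in>P. \<forall>p'\<in>P. p \<noteq> p' \<longrightarrow> 1 \<le> real N * \<bar>p - p'\<bar>) \<and>
     1 / \<eta> \<le> real N \<and> ln (real N) \<le> \<eta> * real (card P)"
    using assms(1) unfolding sep_rich_def by blast
  define K where "K = nat \<lceil>K'\<rceil> + 1"
  have K: "K \<ge> 1" "K' \<le> real K" unfolding K_def by linarith+
  \<comment> \<open>The entries force, in turn: \<open>4 * \<eta>\<close> at most
    \<open>\<epsilon> / 48\<close>, below the required \<open>\<epsilon> / 24\<close>;
    \<open>N\<close> at least \<open>21 * K^2\<close>, so that the logarithm of the product is at
    most \<open>2 * ln N\<close>; and \<open>N\<close> at least 2, so that \<open>ln N\<close> is
    positive and \<open>P\<close> is nonempty.\<close>
  define \<eta> where "\<eta> = min (min (\<epsilon> / 192) (1 / (21 * real K ^ 2))) (1 / 2)"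
  have \<eta>: "\<eta> > 0" "\<eta> \<le> \<epsilon> / 192" "\<eta> \<le> 1 / (21 * real K ^ 2)" "\<eta> \<le> 1 / 2"
    using \<epsilon> K by (auto simp: \<eta>_def)
  obtain P and N :: nat where P: "P \<subseteq> A" "finite P" "\<forall>p\<in>P. \<bar>p\<bar> \<le> K'"
    "\<forall>p\<in>P. \<forall>p'\<in>P. p \<noteq> p' \<longrightarrow> 1 \<le> real N * \<bar>p - p'\<bar>"
    "1 / \<eta> \<le> real N" "ln (real N) \<le> \<eta> * real (card P)"
    using K'[OF \<eta>(1)] by blast
  have "2 \<le> 1 / \<eta>" using \<eta> by (simp add: field_simps)
  hence N2: "real N \<ge> 2" using P(5) by linarith
  hence lnN: "ln (real N) > 0" by simp
  have "21 * real K ^ 2 \<le> 1 / \<eta>" using \<eta>(1,3) K by (simp add: field_simps)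
  hence KN: "21 * real K ^ 2 \<le> real N" using P(5) by linarith
  have K0: "21 * real K ^ 2 > 0" using K by simp
  have "192 / \<epsilon> \<le> 1 / \<eta>" using \<eta>(1,2) \<epsilon> by (simp add: field_simps)
  hence "192 / \<epsilon> \<le> real N" using P(5) by linarith
  hence "real N * \<epsilon> \<ge> 192" using \<epsilon> by (simp add: field_simps)
  hence Ne: "real N * \<epsilon> \<ge> 6" by linarith
  have cP: "real (card P) > 0" using lnN P(6) \<eta>(1) by (smt (verit) mult_nonneg_nonpos of_nat_0_le_iff)
  have "ln (21 * real K ^ 2 * real N) = ln (21 * real K ^ 2) + ln (real N)"
    using K0 N2 by (subst ln_mult) auto
  also have "ln (21 * real K ^ 2) \<le> ln (real N)" using K0 KN by (subst ln_le_cancel_iff) linarith+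
  finally have "2 * ln (21 * real K ^ 2 * real N) \<le> 4 * ln (real N)" by simp
  also have "\<dots> \<le> 4 * (\<eta> * real (card P))" using P(6) by simp
  also have "\<dots> \<le> 4 * (\<epsilon> / 192 * real (card P))"
    using \<eta> by (intro mult_left_mono mult_right_mono) auto
  also have "\<dots> < \<epsilon> / 24 * real (card P)" using cP \<epsilon> by simp
  finally have "2 * ln (21 * real K ^ 2 * real N) < \<epsilon> / 24 * real (card P)" .
  moreover have "P \<noteq> {}" "N \<ge> 1" using cP N2 by auto
  moreover have "\<bar>p\<bar> \<le> real K" if "p \<in> P" for p using P(3) that K(2) by force
  moreover have "1 \<le> real N * \<bar>p - p'\<bar>" if "p \<in> P" "p' \<in> P" "p \<noteq> p'" for p p'
    using P(4) that by blast
  ultimately obtain B where B: "B \<in> sets lebesgue" "emeasure lebesgue B \<le> ennreal \<epsilon>"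
    "\<forall>x c. 1 \<le> c \<and> c \<le> 2 \<longrightarrow> (\<exists>p\<in>P. x + c * p \<notin> {0..1} - B)"
    using avoid_separated_set[OF P(2) _ K(1) _ _ \<epsilon> Ne] by metis
  have "\<forall>x c. 1 \<le> c \<and> c \<le> 2 \<longrightarrow> (\<exists>p\<in>A. x + c * p \<notin> {0..1} - B)"
    using B(3) P(1) by (meson subsetD)
  thus ?thesis using B(1,2) by (intro bexI[of _ B] conjI)
qed

text \<open>Scales between 1 and 2 suffice once all rational multiples of \<open>A\<close> are
  treated: for any nonzero \<open>c\<close> there is a rational \<open>r\<close> of the same sign
  with \<open>c / r\<close> in that range, and the copy of \<open>A\<close> with scale
  \<open>c\<close> is the copy of \<open>r * A\<close> with scale \<open>c / r\<close>.\<close>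

lemma sep_rich_not_universal:
  assumes A: "sep_rich A" and AE: "A \<subseteq> E"
  shows "\<not> measure_universal E"
proof
  assume univ: "measure_universal E"
  define s where "s = from_nat_into (\<rat> - {0::real})"
  have cs: "countable (\<rat> - {0::real})" by (simp add: countable_rat)
  have "1 \<in> \<rat> - {0::real}" by simp
  hence ne: "\<rat> - {0::real} \<noteq> {}" by blast
  have s0: "s m \<noteq> 0" for m using from_nat_into[OF ne] unfolding s_def by blast
  \<comment> \<open>The weights sum to 1/2, so half of the unit interval survives the removal of all
    \<open>B m\<close>.\<close>
  have "\<forall>m. \<exists>B. B\<in>sets lebesgue \<and> emeasure lebesgue B \<le> ennreal ((1/2) ^ (m + 2)) \<and>
    (\<forall>x c. 1 \<le> c \<and> c \<le> 2 \<longrightarrow> (\<exists>p\<in>(\<lambda>a. s m * a) ` A. x + c * p \<notin> {0..1} - B))"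
  proof
    fix m
    have "(1/2::real) ^ (m + 2) > 0" by (rule zero_less_power) simp
    from sep_rich_avoid[OF sep_rich_scale[OF A s0, of m] this]
    show "\<exists>B. B\<in>sets lebesgue \<and> emeasure lebesgue B \<le> ennreal ((1/2) ^ (m + 2)) \<and>
      (\<forall>x c. 1 \<le> c \<and> c \<le> 2 \<longrightarrow> (\<exists>p\<in>(\<lambda>a. s m * a) ` A. x + c * p \<notin> {0..1} - B))"
      unfolding Bex_def[of "sets lebesgue"] .
  qed
  from choice[OF this] obtain B where B: "\<And>m. B m \<in> sets lebesgue" "\<And>m. emeasure lebesgue (B m) \<le> ennreal ((1/2) ^ (m + 2))"
    "\<And>m x c. 1 \<le> c \<Longrightarrow> c \<le> 2 \<Longrightarrow> (\<exists>p\<in>(\<lambda>a. s m * a) ` A. x + c * p \<notin> {0..1} - B m)"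
    by blast
  define L where "L = {0..1} - (\<Union>m. B m)"
  have Bs: "(\<Union>m. B m) \<in> sets lebesgue" using B(1) by blast
  have Ls: "L \<in> sets lebesgue" unfolding L_def using Bs by (intro sets.Diff) auto
  have sums: "(\<lambda>m. (1/2::real) ^ (m + 2)) sums (1/2)"
    using sums_mult[OF geometric_sums[of "1/2::real"], of "1/4"] by (simp add: power_add power2_eq_square)
  have "emeasure lebesgue (\<Union>m. B m) \<le> (\<Sum>m. emeasure lebesgue (B m))"
    using B(1) by (intro emeasure_subadditive_countably) auto
  also have "\<dots> \<le> (\<Sum>m. ennreal ((1/2) ^ (m + 2)))"
    using B(2) by (intro suminf_le) auto
  also have "\<dots> = ennreal (1/2)"
    using sums by (intro suminf_ennreal_eq) auto
  finally have mB: "emeasure lebesgue (\<Union>m. B m) \<le> ennreal (1/2)" .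
  have "emeasure lebesgue L > 0"
  proof (rule ccontr)
    assume "\<not> ?thesis"
    hence L0: "emeasure lebesgue L = 0" by (simp add: not_less)
    have "emeasure lebesgue {0..1::real} \<le> emeasure lebesgue (L \<union> (\<Union>m. B m))"
      using Ls Bs by (intro emeasure_mono) (auto simp: L_def)
    also have "\<dots> \<le> emeasure lebesgue L + emeasure lebesgue (\<Union>m. B m)"
      using Ls Bs by (rule emeasure_subadditive)
    also have "\<dots> \<le> ennreal (1/2)" using L0 mB by simp
    finally have "ennreal 1 \<le> ennreal (1/2)" by simp
    thus False by (subst (asm) ennreal_le_iff) auto
  qed
  then obtain x c where c: "c \<noteq> 0" and sub: "(\<lambda>e. x + c * e) ` E \<subseteq> L"
    using univ Ls unfolding measure_universal_def by blast
  have "\<exists>r\<in>\<rat>. r \<noteq> 0 \<and> 1 \<le> c / r \<and> c / r \<le> 2"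
  proof (cases "c > 0")
    case True
    then obtain r where "r \<in> \<rat>" "c / 2 < r" "r < c" using Rats_dense_in_real[of "c/2" c] by auto
    thus ?thesis using True by (intro bexI[of _ r]) (auto simp: field_simps)
  next
    case False
    then obtain r where "r \<in> \<rat>" "c < r" "r < c / 2" using Rats_dense_in_real[of c "c/2"] c by auto
    thus ?thesis using False c by (intro bexI[of _ r]) (auto simp: field_simps)
  qed
  then obtain r where r: "r \<in> \<rat> - {0}" "1 \<le> c / r" "c / r \<le> 2" by blast
  obtain m where m: "s m = r" unfolding s_def using from_nat_into_surj[OF cs r(1)] by blast
  obtain a where a: "a \<in> A" "x + (c / r) * (r * a) \<notin> {0..1} - B m"
    using B(3)[OF r(2,3), of m x] m by auto
  have "x + c * a \<in> L" using sub a(1) AE by blast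
  moreover have "x + (c / r) * (r * a) = x + c * a" using r(1) by simp
  ultimately show False using a(2) by (auto simp: L_def)
qed

section \<open>Decay of lacunary sequences\<close>

lemma lacunary_with_ratio_mono:
  assumes "lacunary_with_ratio b q" "q \<le> q'" "q' < 1"
  shows "lacunary_with_ratio b q'"
  unfolding lacunary_with_ratio_def
proof (intro conjI allI impI)
  fix i :: nat assume i: "i \<ge> 1"
  have "b (i + 1) \<le> q * b i" "0 < b i" using assms(1) i by (auto simp: lacunary_with_ratio_def)
  moreover have "q * b i \<le> q' * b i" using assms(2) \<open>0 < b i\<close> by (intro mult_right_mono) auto
  ultimately show "b (i + 1) \<le> q' * b i" "0 < b i" by linarith+
qed (use assms in \<open>auto simp: lacunary_with_ratio_def\<close>)

lemma lacunary_power: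
  assumes b: "lacunary_with_ratio b q" and i: "1 \<le> i"
  shows "b (i + k) \<le> q ^ k * b i"
proof (induction k)
  case (Suc k)
  have "b (i + k + 1) \<le> q * b (i + k)" using b i by (simp add: lacunary_with_ratio_def)
  also have "\<dots> \<le> q * (q ^ k * b i)"
    using Suc b by (intro mult_left_mono) (auto simp: lacunary_with_ratio_def)
  finally show ?case by (simp add: algebra_simps)
qed simp

lemma lacunary_less:
  assumes b: "lacunary_with_ratio b q" and ij: "1 \<le> i" "i < j"
  shows "b j \<le> q * b i"
proof -
  have q: "0 < q" "q < 1" "0 < b i" using b ij by (auto simp: lacunary_with_ratio_def)
  have "b j \<le> q ^ (j - i) * b i" using lacunary_power[OF b ij(1), of "j - i"] ij by simp
  also have "\<dots> \<le> q ^ 1 * b i"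
    using q ij by (intro mult_right_mono power_decreasing) auto
  finally show ?thesis by simp
qed

lemma lacunary_antimono:
  assumes b: "lacunary_with_ratio b q" and ij: "1 \<le> i" "i \<le> j"
  shows "b j \<le> b i"
proof (cases "i = j")
  case False
  have "b j \<le> q * b i" using b ij False by (intro lacunary_less) auto
  also have "\<dots> \<le> 1 * b i" using b ij by (intro mult_right_mono) (auto simp: lacunary_with_ratio_def less_imp_le)
  finally show ?thesis by simp
qed simp

text \<open>The ends \<open>e * v\<close> and \<open>v / e\<close> of the window have ratio
  \<open>e^2\<close>. From the first index in the window, \<open>J\<close> further steps shrink the
  term by at least this factor and so leave the window for good. The bound depends neither on
  \<open>v\<close> nor on \<open>N\<close>.\<close>

lemma lacunary_window_card:
  assumes d: "lacunary_with_ratio d q" and v: "v > 0" and e: "e > 0" and J: "q ^ J \<le> e\<^sup>2"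
  shows "card {j\<in>{1..N}. e * v < d j \<and> e * d j < v} \<le> J"
proof (cases "{j\<in>{1..N}. e * v < d j \<and> e * d j < v} = {}")
  case False
  define W where "W = {j\<in>{1..N}. e * v < d j \<and> e * d j < v}"
  define k where "k = Min W"
  have finW: "finite W" by (simp add: W_def)
  hence k: "k \<in> W" "\<And>j. j \<in> W \<Longrightarrow> k \<le> j" using False unfolding k_def W_def[symmetric] by auto
  have "j < k + J" if "j \<in> W" for j
  proof (rule ccontr)
    assume "\<not> j < k + J"
    hence "d j \<le> d (k + J)" using k(1) by (intro lacunary_antimono[OF d]) (auto simp: W_def)
    also have "\<dots> \<le> q ^ J * d k" using k(1) by (intro lacunary_power[OF d]) (auto simp: W_def)
    also have "\<dots> \<le> e\<^sup>2 * d k"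
      using J k(1) d by (intro mult_right_mono) (auto simp: W_def lacunary_with_ratio_def less_imp_le)
    also have "\<dots> = e * (e * d k)" by (simp add: power2_eq_square)
    also have "\<dots> < e * v" using k(1) e by (simp add: W_def)
    finally show False using that by (simp add: W_def)
  qed
  hence "W \<subseteq> {k..<k + J}" using k(2) by auto
  hence "card W \<le> card {k..<k + J}" by (intro card_mono) auto
  thus ?thesis by (simp add: W_def)
next
  case True
  thus ?thesis by (simp only: card.empty)
qed

section \<open>Separation of sums and differences of lacunary terms\<close>

text \<open>If \<open>i < i'\<close>, then \<open>b i - b i'\<close> is at least
  \<open>(1 - q) * b i\<close>, that is \<open>2 * e * b i\<close>. For either sign only one of the
  two \<open>d\<close> terms works against this gap, and it costs at most \<open>e * b i\<close>, so
  half of the gap remains. If \<open>i = i'\<close>, the gap is that between two terms of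
  \<open>d\<close>.\<close>

lemma dominated_gap:
  fixes \<sigma> :: real
  assumes b: "lacunary_with_ratio b q" and d: "lacunary_with_ratio d q"
    and \<sigma>: "\<bar>\<sigma>\<bar> = 1" and e: "e = (1 - q) / 2"
    and ij: "1 \<le> i" "1 \<le> j" "d j \<le> e * b i" and ij': "1 \<le> i'" "1 \<le> j'" "d j' \<le> e * b i'"
    and ne: "(i, j) \<noteq> (i', j')"
    and g: "g \<le> b i" "g \<le> b i'" "g \<le> d j" "g \<le> d j'"
  shows "e * g \<le> \<bar>(b i + \<sigma> * d j) - (b i' + \<sigma> * d j')\<bar>"
proof -
  have q: "0 < q" "q < 1" using b by (auto simp: lacunary_with_ratio_def)
  have e01: "0 < e" "e < 1" using q e by auto
  have \<sigma>': "\<sigma> = 1 \<or> \<sigma> = -1" using \<sigma> by linarith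
  have diff: "e * g \<le> (b k + \<sigma> * d l) - (b k' + \<sigma> * d l')"
    if "1 \<le> k" "1 \<le> l" "d l \<le> e * b k" "1 \<le> k'" "1 \<le> l'" "d l' \<le> e * b k'" "g \<le> b k" "k < k'" for k l k' l'
  proof -
    have pos: "0 < b k" "0 < d l" "0 < b k'" "0 < d l'" using b d that by (auto simp: lacunary_with_ratio_def)
    have 1: "b k' \<le> q * b k" using lacunary_less[OF b] that by simp
    have "e * b k' \<le> e * (q * b k)" using 1 e01 by simp
    also have "\<dots> \<le> e * (1 * b k)" using q e01 pos by (intro mult_left_mono mult_right_mono) auto
    finally have 2: "d l' \<le> e * b k" using that by simp
    have 3: "b k = q * b k + 2 * (e * b k)" unfolding e by (simp add: field_simps)
    have 4: "e * g \<le> e * b k" using that e01 by simp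
    from \<sigma>' show ?thesis
    proof
      assume "\<sigma> = 1" thus ?thesis using 1 2 3 4 pos by simp
    next
      assume "\<sigma> = -1" thus ?thesis using 1 2 3 4 pos that by simp
    qed
  qed
  have same: "e * g \<le> \<bar>d l - d l'\<bar>" if "1 \<le> l" "l < l'" "g \<le> d l" for l l'
  proof -
    have "d l' \<le> q * d l" using lacunary_less[OF d] that by simp
    moreover have "d l = q * d l + 2 * (e * d l)" unfolding e by (simp add: field_simps)
    moreover have "e * g \<le> e * d l" using that e01 by simp
    moreover have "0 < e * d l" using d that e01 by (auto simp: lacunary_with_ratio_def)
    ultimately show ?thesis by linarith
  qed
  consider "i < i'" | "i' < i" | "i = i'" "j < j'" | "i = i'" "j' < j" using ne by fastforce
  thus ?thesis
  proof cases
    case 1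
    show ?thesis using diff[OF ij ij' g(1) 1] by linarith
  next
    case 2
    show ?thesis using diff[OF ij' ij g(2) 2] by linarith
  next
    case 3
    show ?thesis using same[OF ij(2) 3(2) g(3)] 3(1) \<sigma>' by auto
  next
    case 4
    show ?thesis using same[OF ij'(2) 4(2) g(4)] 4(1) \<sigma>' by auto
  qed
qed

text \<open>In an \<open>M\<close> by \<open>N\<close> box of index pairs, at most half of the pairs
  have terms of comparable size. One of the two dominance regions therefore contains at least a
  quarter of the box, and on it the gaps are at least \<open>e * g\<close>, where \<open>g\<close>
  bounds all terms involved from below.\<close>

lemma lacunary_sums_sep_rich:
  fixes \<sigma> :: real
  assumes b: "lacunary_with_ratio b q" and d: "lacunary_with_ratio d q" and \<sigma>: "\<bar>\<sigma>\<bar> = 1"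
    and growth: "\<And>\<eta> Z. \<eta> > 0 \<Longrightarrow> \<exists>M\<ge>Z. \<exists>N\<ge>Z. - ln (b M) \<le> \<eta> * (real M * real N) \<and>
      - ln (d N) \<le> \<eta> * (real M * real N)"
  shows "sep_rich {b i + \<sigma> * d j | i j. 1 \<le> i \<and> 1 \<le> j}"
  unfolding sep_rich_def
proof (intro exI[of _ "b 1 + d 1"] allI impI)
  fix \<eta> :: real assume \<eta>: "\<eta> > 0"
  have q: "0 < q" "q < 1" using b by (auto simp: lacunary_with_ratio_def)
  have pos: "\<And>i. 1 \<le> i \<Longrightarrow> 0 < b i" "\<And>j. 1 \<le> j \<Longrightarrow> 0 < d j"
    using b d by (auto simp: lacunary_with_ratio_def)
  define e where "e = (1 - q) / 2"
  have e: "e > 0" using q by (simp add: e_def)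
  \<comment> \<open>\<open>J\<close> depends only on \<open>q\<close>, so the box can be chosen
    large compared with it.\<close>
  obtain J where J: "q ^ J < e\<^sup>2" using real_arch_pow_inv[of "e\<^sup>2" q] q e by auto
  define D where "D = 1 / e + 1 / \<eta> + 2"
  have D: "D > 0" using e \<eta> by (simp add: D_def add_pos_pos)
  \<comment> \<open>\<open>2 * J\<close> makes the comparable pairs at most half of the box; the
    ceiling makes \<open>ln D\<close> negligible against the number of pairs.\<close>
  define Z where "Z = 2 * J + 1 + nat \<lceil>8 * \<bar>ln D\<bar> / \<eta>\<rceil>"
  obtain M N where MN: "M \<ge> Z" "N \<ge> Z" "- ln (b M) \<le> \<eta> / 8 * (real M * real N)"
      "- ln (d N) \<le> \<eta> / 8 * (real M * real N)"
    using growth[of "\<eta> / 8" Z] \<eta> by auto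
  have M1: "1 \<le> M" "1 \<le> N" "2 * J \<le> N" using MN by (auto simp: Z_def)
  have "8 * \<bar>ln D\<bar> / \<eta> \<le> real Z" unfolding Z_def by linarith
  also have "\<dots> \<le> real M * 1" using MN by simp
  also have "\<dots> \<le> real M * real N" using M1 by (intro mult_left_mono) auto
  finally have D2: "ln D \<le> \<eta> / 8 * (real M * real N)" using \<eta> by (simp add: field_simps abs_le_iff)
  \<comment> \<open>The 0 ensures that \<open>exp w\<close> is at least 1, so the additive constants
    in the bound for \<open>L\<close> can be absorbed into \<open>D * exp w\<close>.\<close>
  define w where "w = max 0 (max (- ln (b M)) (- ln (d N)))"
  have w: "w \<le> \<eta> / 8 * (real M * real N)" "0 \<le> w"
    using MN(3,4) \<eta> unfolding w_def by (intro max.boundedI; simp) (rule max.cobounded1)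
  define g where "g = exp (- w)"
  have g0: "g > 0" by (simp add: g_def)
  have "g \<le> exp (ln (b M))" "g \<le> exp (ln (d N))" unfolding g_def w_def exp_le_cancel_iff by linarith+
  hence "g \<le> b M" "g \<le> d N" using pos M1 by simp_all
  hence g: "\<And>i. i \<in> {1..M} \<Longrightarrow> g \<le> b i" "\<And>j. j \<in> {1..N} \<Longrightarrow> g \<le> d j"
    using lacunary_antimono[OF b] lacunary_antimono[OF d] by (meson atLeastAtMost_iff order_trans)+
  define f where "f = (\<lambda>(i, j). b i + \<sigma> * d j)"
  define G1 where "G1 = {(i, j) \<in> {1..M} \<times> {1..N}. d j \<le> e * b i}"
  define G2 where "G2 = {(i, j) \<in> {1..M} \<times> {1..N}. b i \<le> e * d j}"
  define W where "W i = {j\<in>{1..N}. e * b i < d j \<and> e * d j < b i}" for i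
  have fin: "finite G1" "finite G2"
    by (rule finite_subset[of _ "{1..M} \<times> {1..N}"]; auto simp: G1_def G2_def)+
  \<comment> \<open>The box is covered by the two dominance regions and, over each \<open>i\<close>,
    the window of those \<open>j\<close> for which neither term dominates.\<close>
  have "M * N = card ({1..M} \<times> {1..N})" by simp
  also have "\<dots> \<le> card ((G1 \<union> G2) \<union> Sigma {1..M} W)"
    using fin by (intro card_mono) (auto simp: G1_def G2_def W_def)
  also have "\<dots> \<le> (card G1 + card G2) + card (Sigma {1..M} W)"
    by (meson add_mono card_Un_le le_refl order_trans)
  also have "card (Sigma {1..M} W) = (\<Sum>i\<in>{1..M}. card (W i))" by (simp add: W_def)
  also have "\<dots> \<le> (\<Sum>i\<in>{1..M}. J)"
    unfolding W_def using pos e J by (intro sum_mono lacunary_window_card[OF d]) auto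
  also have "\<dots> = M * J" by simp
  finally have "M * N \<le> card G1 + card G2 + M * J" by simp
  moreover have "2 * (M * J) \<le> M * N" using mult_left_mono[OF M1(3), of M] by (simp add: ac_simps)
  moreover have "x \<le> 2 * (y + z)" if "x \<le> y + z + t" "2 * t \<le> x" for x y z t :: nat
    using that by presburger
  ultimately have two: "M * N \<le> 2 * (card G1 + card G2)" by blast
  have sep1: "e * g \<le> \<bar>f x - f y\<bar>" if "x \<in> G1" "y \<in> G1" "x \<noteq> y" for x y
    using that g unfolding f_def G1_def
    by (auto intro!: dominated_gap[OF b d \<sigma> e_def])
  \<comment> \<open>The roles of \<open>b\<close> and \<open>d\<close> are exchanged; multiplying by
    \<sigma>, whose square is 1, turns \<open>d j + \<sigma> * b i\<close> back into
    \<open>f (i, j)\<close>.\<close>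
  have sep2: "e * g \<le> \<bar>f x - f y\<bar>" if "x \<in> G2" "y \<in> G2" "x \<noteq> y" for x y
  proof -
    obtain i j i' j' where xy: "x = (i, j)" "y = (i', j')" by (cases x, cases y) auto
    have "e * g \<le> \<bar>(d j + \<sigma> * b i) - (d j' + \<sigma> * b i')\<bar>"
      using that g unfolding xy G2_def by (intro dominated_gap[OF d b \<sigma> e_def]) auto
    also have "\<dots> = \<bar>\<sigma>\<bar> * \<bar>(d j + \<sigma> * b i) - (d j' + \<sigma> * b i')\<bar>" using \<sigma> by simp
    also have "\<dots> = \<bar>f x - f y\<bar>"
    proof -
      have "\<sigma> = 1 \<or> \<sigma> = -1" using \<sigma> by linarith
      thus ?thesis by (auto simp: f_def xy)
    qed
    finally show ?thesis .
  qed
  obtain G where G: "G \<subseteq> {1..M} \<times> {1..N}" "M * N \<le> 4 * card G"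
    "\<And>x y. x \<in> G \<Longrightarrow> y \<in> G \<Longrightarrow> x \<noteq> y \<Longrightarrow> e * g \<le> \<bar>f x - f y\<bar>"
  proof (cases "card G1 \<le> card G2")
    case True
    show ?thesis by (rule that[of G2]) (use two True sep2 in \<open>auto simp: G2_def\<close>)
  next
    case False
    show ?thesis by (rule that[of G1]) (use two False sep1 in \<open>auto simp: G1_def\<close>)
  qed
  have eg: "e * g > 0" using e g0 by simp
  have inj: "inj_on f G"
  proof (rule inj_onI, rule ccontr)
    fix x y assume "x \<in> G" "y \<in> G" "f x = f y" "x \<noteq> y"
    thus False using G(3)[of x y] eg by simp
  qed
  \<comment> \<open>Adding the two ceilings meets both lower bounds at once:
    \<open>1 / (e * g)\<close> for the separation and \<open>1 / \<eta>\<close> for the size of the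
    denominator.\<close>
  define L where "L = nat \<lceil>1 / (e * g)\<rceil> + nat \<lceil>1 / \<eta>\<rceil>"
  have L1: "1 / (e * g) \<le> real L" "1 / \<eta> \<le> real L" unfolding L_def by linarith+
  have L2: "real L \<le> 1 / (e * g) + 1 / \<eta> + 2"
  proof -
    have "1 / (e * g) > 0" "1 / \<eta> > 0" using eg \<eta> by auto
    thus ?thesis unfolding L_def by linarith
  qed
  have L0: "real L > 0" using L1(2) \<eta> by (smt (verit) divide_pos_pos)
  have "1 / \<eta> * 1 \<le> 1 / \<eta> * exp w" using w \<eta> by (intro mult_left_mono) auto
  moreover have "2 * 1 \<le> 2 * exp w" using w by (intro mult_left_mono) auto
  moreover have "1 / (e * g) = 1 / e * exp w" by (simp add: g_def exp_minus field_simps)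
  ultimately have "real L \<le> D * exp w" using L2 unfolding D_def distrib_right by linarith
  hence "ln (real L) \<le> ln (D * exp w)" using L0 D by (subst ln_le_cancel_iff) auto
  also have "\<dots> = ln D + w" using D by (simp add: ln_mult)
  also have "\<dots> \<le> \<eta> / 4 * (real M * real N)" using D2 w by simp
  also have "real M * real N \<le> 4 * real (card G)"
    using G(2) by (metis of_nat_le_iff of_nat_mult of_nat_numeral)
  hence "\<eta> / 4 * (real M * real N) \<le> \<eta> / 4 * (4 * real (card G))" using \<eta> by (intro mult_left_mono) auto
  finally have L3: "ln (real L) \<le> \<eta> * real (card (f ` G))" by (simp add: card_image[OF inj])
  have sepf: "1 \<le> real L * \<bar>f x - f y\<bar>" if "x \<in> G" "y \<in> G" "f x \<noteq> f y" for x y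
  proof -
    have "1 = 1 / (e * g) * (e * g)" using e g0 by simp
    also have "\<dots> \<le> real L * \<bar>f x - f y\<bar>"
      using L1 G(3)[of x y] that eg by (intro mult_mono) auto
    finally show ?thesis .
  qed
  have bnd: "\<bar>f x\<bar> \<le> b 1 + d 1" if xG: "x \<in> G" for x
  proof -
    obtain i j where ij: "x = (i, j)" "1 \<le> i" "1 \<le> j" using xG G(1) by (cases x) auto
    have "\<bar>f x\<bar> \<le> \<bar>b i\<bar> + \<bar>\<sigma> * d j\<bar>" unfolding ij f_def by simp
    also have "\<dots> = b i + d j" using pos(1)[OF ij(2)] pos(2)[OF ij(3)] \<sigma> by (simp add: abs_mult)
    also have "\<dots> \<le> b 1 + d 1"
      using lacunary_antimono[OF b, of 1 i] lacunary_antimono[OF d, of 1 j] ij by simp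
    finally show ?thesis .
  qed
  have "f ` G \<subseteq> {b i + \<sigma> * d j | i j. 1 \<le> i \<and> 1 \<le> j}" using G(1) by (force simp: f_def)
  moreover have "finite (f ` G)" using G(1) by (meson finite_SigmaI finite_atLeastAtMost finite_imageI finite_subset)
  moreover have "\<forall>p\<in>f ` G. \<bar>p\<bar> \<le> b 1 + d 1" using bnd by blast
  moreover have "\<forall>p\<in>f ` G. \<forall>p'\<in>f ` G. p \<noteq> p' \<longrightarrow> 1 \<le> real L * \<bar>p - p'\<bar>" using sepf by blast
  ultimately show "\<exists>P\<subseteq>{b i + \<sigma> * d j | i j. 1 \<le> i \<and> 1 \<le> j}. \<exists>N::nat. finite P \<and> (\<forall>p\<in>P. \<bar>p\<bar> \<le> b 1 + d 1) \<and>
       (\<forall>p\<in>P. \<forall>p'\<in>P. p \<noteq> p' \<longrightarrow> 1 \<le> real N * \<bar>p - p'\<bar>) \<and>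
       1 / \<eta> \<le> real N \<and> ln (real N) \<le> \<eta> * real (card P)"
    using L1(2) L3 by - (intro exI[of _ "f ` G"] conjI exI[of _ L]; assumption)
qed

section \<open>Choice of the box from the growth rates\<close>

text \<open>With \<open>M\<close> and \<open>N\<close> the ceilings of
  \<open>T powr (1 / \<alpha>)\<close> and \<open>T powr (1 / \<beta>)\<close>, both
  \<open>u M\<close> and \<open>v N\<close> are at most a constant times \<open>C * T\<close>, while
  \<open>M * N\<close> is at least \<open>T powr (1 / \<alpha> + 1 / \<beta>)\<close>. Since
  \<open>C\<close> may depend on \<eta>, one hypothesis serves both growth conditions: a small
  \<open>C\<close> for the little-o case, a fixed \<open>C\<close> with exponent sum above 1 for the
  big-O case.\<close>

lemma growth_index_pairs:
  fixes u v :: "nat \<Rightarrow> real"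
  assumes \<alpha>\<beta>: "\<alpha> > 0" "\<beta> > 0" and \<eta>: "\<eta> > 0"
    and growth: "\<And>\<eta>. \<eta> > 0 \<Longrightarrow> \<exists>C\<ge>0. (\<forall>\<^sub>F i in sequentially. u i \<le> C * real i powr \<alpha>) \<and>
      (\<forall>\<^sub>F j in sequentially. v j \<le> C * real j powr \<beta>) \<and>
      (\<forall>\<^sub>F T in at_top. C * T \<le> \<eta> * T powr (1 / \<alpha> + 1 / \<beta>))"
  shows "\<exists>M\<ge>Z. \<exists>N\<ge>Z. u M \<le> \<eta> * (real M * real N) \<and> v N \<le> \<eta> * (real M * real N)"
proof -
  \<comment> \<open>For \<open>T\<close> at least 1, rounding up at most doubles
    \<open>T powr (1 / \<gamma>)\<close>, so its power with exponent \<gamma> grows by at most the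
    factor \<open>k\<close>. Using \<open>growth\<close> with \<open>\<eta> / k\<close> cancels this
    factor.\<close>
  define k where "k = 2 powr (max \<alpha> \<beta>)"
  have k: "k > 0" by (simp add: k_def)
  obtain C where C: "C \<ge> 0" and ev: "\<forall>\<^sub>F i in sequentially. u i \<le> C * real i powr \<alpha>"
      "\<forall>\<^sub>F j in sequentially. v j \<le> C * real j powr \<beta>"
      "\<forall>\<^sub>F T in at_top. C * T \<le> \<eta> / k * T powr (1 / \<alpha> + 1 / \<beta>)"
    using growth[of "\<eta> / k"] \<eta> k by auto
  define R where "R \<gamma> T = nat \<lceil>T powr (1 / \<gamma>)\<rceil>" for \<gamma> T :: real
  have limR: "filterlim (R \<gamma>) sequentially at_top" if "\<gamma> > 0" for \<gamma>
  proof -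
    have "filterlim (\<lambda>T::real. T powr (1 / \<gamma>)) at_top at_top" using that by real_asymp
    hence "filterlim (\<lambda>T. real (R \<gamma> T)) at_top at_top"
      by (rule filterlim_at_top_mono) (intro always_eventually allI, unfold R_def, linarith)
    thus ?thesis by (simp add: filterlim_sequentially_iff_filterlim_real)
  qed
  have R: "T powr (1 / \<gamma>) \<le> real (R \<gamma> T)" "real (R \<gamma> T) powr \<gamma> \<le> k * T"
    if \<gamma>: "\<gamma> > 0" "\<gamma> \<le> max \<alpha> \<beta>" and T: "T \<ge> 1" for \<gamma> T
  proof -
    show "T powr (1 / \<gamma>) \<le> real (R \<gamma> T)" unfolding R_def by linarith
    have "1 \<le> T powr (1 / \<gamma>)" using \<gamma> T by (intro ge_one_powr_ge_zero) auto
    hence "real (R \<gamma> T) \<le> 2 * T powr (1 / \<gamma>)" unfolding R_def by linarith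
    hence "real (R \<gamma> T) powr \<gamma> \<le> (2 * T powr (1 / \<gamma>)) powr \<gamma>" using \<gamma> by (intro powr_mono2) auto
    also have "\<dots> = 2 powr \<gamma> * T" using \<gamma> T by (simp add: powr_mult powr_powr)
    also have "\<dots> \<le> k * T" unfolding k_def using \<gamma> T by (intro mult_right_mono powr_mono) auto
    finally show "real (R \<gamma> T) powr \<gamma> \<le> k * T" .
  qed
  have "\<forall>\<^sub>F T in at_top. u (R \<alpha> T) \<le> C * real (R \<alpha> T) powr \<alpha> \<and> v (R \<beta> T) \<le> C * real (R \<beta> T) powr \<beta> \<and>
     C * T \<le> \<eta> / k * T powr (1 / \<alpha> + 1 / \<beta>) \<and> Z \<le> R \<alpha> T \<and> Z \<le> R \<beta> T \<and> 1 \<le> T"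
    using limR[OF \<alpha>\<beta>(1)] limR[OF \<alpha>\<beta>(2)] ev
    by (intro eventually_conj eventually_ge_at_top)
      (auto simp: filterlim_iff)
  then obtain T where T: "u (R \<alpha> T) \<le> C * real (R \<alpha> T) powr \<alpha>" "v (R \<beta> T) \<le> C * real (R \<beta> T) powr \<beta>"
     "C * T \<le> \<eta> / k * T powr (1 / \<alpha> + 1 / \<beta>)" "Z \<le> R \<alpha> T" "Z \<le> R \<beta> T" "1 \<le> T"
    using eventually_happens'[OF trivial_limit_at_top_linorder] by blast
  have "C * (k * T) = k * (C * T)" by simp
  also have "\<dots> \<le> k * (\<eta> / k * T powr (1 / \<alpha> + 1 / \<beta>))" using T(3) k by (intro mult_left_mono) auto
  also have "\<dots> = \<eta> * (T powr (1 / \<alpha>) * T powr (1 / \<beta>))" using k by (simp add: powr_add)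
  also have "\<dots> \<le> \<eta> * (real (R \<alpha> T) * real (R \<beta> T))"
    using R(1)[OF \<alpha>\<beta>(1) _ T(6)] R(1)[OF \<alpha>\<beta>(2) _ T(6)] \<eta> by (intro mult_left_mono mult_mono) auto
  finally have *: "C * (k * T) \<le> \<eta> * (real (R \<alpha> T) * real (R \<beta> T))" .
  have "C * real (R \<alpha> T) powr \<alpha> \<le> C * (k * T)" "C * real (R \<beta> T) powr \<beta> \<le> C * (k * T)"
    using R(2)[OF \<alpha>\<beta>(1) _ T(6)] R(2)[OF \<alpha>\<beta>(2) _ T(6)] C by (auto intro: mult_left_mono)
  thus ?thesis using T * by (intro exI[of _ "R \<alpha> T"] exI[of _ "R \<beta> T"] conjI) linarith+
qed

section \<open>Both growth conditions and both signs\<close>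

theorem corollary4:
  fixes S1 S2 :: "real set" and b d :: "nat \<Rightarrow> real"
  assumes "lacunary b" and "lacunary d"
    and "b ` {1..} \<subseteq> S1" and "d ` {1..} \<subseteq> S2"
    and "(\<exists>\<alpha> \<beta> :: real. \<alpha> > 1 \<and> \<beta> > 1 \<and> 1 / \<alpha> + 1 / \<beta> \<ge> 1 \<and>
            (\<lambda>i. - ln (b i)) \<in> o(\<lambda>i. real i powr \<alpha>) \<and>
            (\<lambda>j. - ln (d j)) \<in> o(\<lambda>j. real j powr \<beta>)) \<or>
         (\<exists>\<alpha> \<beta> :: real. \<alpha> \<ge> 1 \<and> \<beta> \<ge> 1 \<and> 1 / \<alpha> + 1 / \<beta> > 1 \<and>
            (\<lambda>i. - ln (b i)) \<in> O(\<lambda>i. real i powr \<alpha>) \<and>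
            (\<lambda>j. - ln (d j)) \<in> O(\<lambda>j. real j powr \<beta>))"
  shows "\<not> measure_universal (sumset S1 S2) \<and> \<not> measure_universal (diffset S1 S2)"
proof -
  obtain q1 q2 where q: "lacunary_with_ratio b q1" "lacunary_with_ratio d q2"
    using assms(1,2) unfolding lacunary_def by blast
  \<comment> \<open>The separation argument uses a common ratio; the larger one is valid for both
    sequences.\<close>
  have "max q1 q2 < 1" using q by (simp add: lacunary_with_ratio_def)
  hence b: "lacunary_with_ratio b (max q1 q2)" and d: "lacunary_with_ratio d (max q1 q2)"
    using lacunary_with_ratio_mono[OF q(1)] lacunary_with_ratio_mono[OF q(2)] by auto
  have growth: "\<exists>M\<ge>Z. \<exists>N\<ge>Z. - ln (b M) \<le> \<eta> * (real M * real N) \<and> - ln (d N) \<le> \<eta> * (real M * real N)"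
    if \<eta>: "\<eta> > 0" for \<eta> Z
    using assms(5)
  proof (elim disjE exE conjE)
    fix \<alpha> \<beta> :: real
    assume \<alpha>\<beta>: "\<alpha> > 1" "\<beta> > 1" "1 / \<alpha> + 1 / \<beta> \<ge> 1"
      and o: "(\<lambda>i. - ln (b i)) \<in> o(\<lambda>i. real i powr \<alpha>)" "(\<lambda>j. - ln (d j)) \<in> o(\<lambda>j. real j powr \<beta>)"
    show ?thesis
    proof (rule growth_index_pairs[of \<alpha> \<beta> \<eta>])
      fix \<eta>' :: real assume \<eta>': "\<eta>' > 0"
      \<comment> \<open>Here \<open>C\<close> is \<eta>' itself, so an exponent sum of at least 1 is
        enough.\<close>
      have "\<forall>\<^sub>F T in at_top. \<eta>' * T \<le> \<eta>' * T powr (1 / \<alpha> + 1 / \<beta>)"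
        using eventually_ge_at_top[of 1]
      proof eventually_elim
        case (elim T)
        have "T powr 1 \<le> T powr (1 / \<alpha> + 1 / \<beta>)" using \<alpha>\<beta> elim by (intro powr_mono) auto
        thus ?case using elim \<eta>' by simp
      qed
      moreover have "\<forall>\<^sub>F i in sequentially. - ln (b i) \<le> \<eta>' * real i powr \<alpha>"
        using landau_o.smallD[OF o(1) \<eta>'] by eventually_elim auto
      moreover have "\<forall>\<^sub>F j in sequentially. - ln (d j) \<le> \<eta>' * real j powr \<beta>"
        using landau_o.smallD[OF o(2) \<eta>'] by eventually_elim auto
      ultimately show "\<exists>C\<ge>0. (\<forall>\<^sub>F i in sequentially. - ln (b i) \<le> C * real i powr \<alpha>) \<and>
        (\<forall>\<^sub>F j in sequentially. - ln (d j) \<le> C * real j powr \<beta>) \<and>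
        (\<forall>\<^sub>F T in at_top. C * T \<le> \<eta>' * T powr (1 / \<alpha> + 1 / \<beta>))"
        using \<eta>' by (intro exI[of _ \<eta>']) auto
    qed (use \<alpha>\<beta> \<eta> in auto)
  next
    fix \<alpha> \<beta> :: real
    assume \<alpha>\<beta>: "\<alpha> \<ge> 1" "\<beta> \<ge> 1" "1 / \<alpha> + 1 / \<beta> > 1"
      and O: "(\<lambda>i. - ln (b i)) \<in> O(\<lambda>i. real i powr \<alpha>)" "(\<lambda>j. - ln (d j)) \<in> O(\<lambda>j. real j powr \<beta>)"
    obtain C1 C2 where C: "C1 > 0" "C2 > 0"
      "\<forall>\<^sub>F i in sequentially. norm (- ln (b i)) \<le> C1 * norm (real i powr \<alpha>)"
      "\<forall>\<^sub>F j in sequentially. norm (- ln (d j)) \<le> C2 * norm (real j powr \<beta>)"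
      using O by (auto elim!: landau_o.bigE)
    define C where "C = max C1 C2"
    have C0: "C > 0" using C by (simp add: C_def)
    show ?thesis
    proof (rule growth_index_pairs[of \<alpha> \<beta> \<eta>])
      fix \<eta>' :: real assume \<eta>': "\<eta>' > 0"
      \<comment> \<open>The excess of the exponent sum over 1: \<open>T powr s\<close> eventually
        exceeds the fixed quotient \<open>C / \<eta>'\<close>.\<close>
      define s where "s = 1 / \<alpha> + 1 / \<beta> - 1"
      have s: "s > 0" using \<alpha>\<beta> by (simp add: s_def)
      have "filterlim (\<lambda>T::real. T powr s) at_top at_top" using s by real_asymp
      hence "\<forall>\<^sub>F T in at_top. C / \<eta>' \<le> T powr s" by (simp add: filterlim_at_top)
      hence "\<forall>\<^sub>F T in at_top. C * T \<le> \<eta>' * T powr (1 / \<alpha> + 1 / \<beta>)"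
        using eventually_ge_at_top[of 1]
      proof eventually_elim
        case (elim T)
        have "C * T = \<eta>' * (C / \<eta>' * T)" using \<eta>' by simp
        also have "\<dots> \<le> \<eta>' * (T powr s * T)"
          using elim \<eta>' by (intro mult_left_mono mult_right_mono) auto
        also have "T powr s * T = T powr (s + 1)" using elim by (simp add: powr_add)
        finally show ?case by (simp add: s_def)
      qed
      moreover have "\<forall>\<^sub>F i in sequentially. - ln (b i) \<le> C * real i powr \<alpha>"
        using C(3)
      proof eventually_elim
        case (elim i)
        have "C1 * real i powr \<alpha> \<le> C * real i powr \<alpha>" by (intro mult_right_mono) (auto simp: C_def)
        thus ?case using elim by simp
      qed
      moreover have "\<forall>\<^sub>F j in sequentially. - ln (d j) \<le> C * real j powr \<beta>"
        using C(4)
      proof eventually_elim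
        case (elim j)
        have "C2 * real j powr \<beta> \<le> C * real j powr \<beta>" by (intro mult_right_mono) (auto simp: C_def)
        thus ?case using elim by simp
      qed
      ultimately show "\<exists>C\<ge>0. (\<forall>\<^sub>F i in sequentially. - ln (b i) \<le> C * real i powr \<alpha>) \<and>
        (\<forall>\<^sub>F j in sequentially. - ln (d j) \<le> C * real j powr \<beta>) \<and>
        (\<forall>\<^sub>F T in at_top. C * T \<le> \<eta>' * T powr (1 / \<alpha> + 1 / \<beta>))"
        using C0 by (intro exI[of _ C]) auto
    qed (use \<alpha>\<beta> \<eta> in auto)
  qed
  have "sep_rich {b i + 1 * d j | i j. 1 \<le> i \<and> 1 \<le> j}"
    by (rule lacunary_sums_sep_rich[OF b d _ growth]) auto
  moreover have "{b i + 1 * d j | i j. 1 \<le> i \<and> 1 \<le> j} \<subseteq> sumset S1 S2"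
    using assms(3,4) by (fastforce simp: sumset_def)
  moreover have "sep_rich {b i + (-1) * d j | i j. 1 \<le> i \<and> 1 \<le> j}"
    by (rule lacunary_sums_sep_rich[OF b d _ growth]) auto
  moreover have "{b i + (-1) * d j | i j. 1 \<le> i \<and> 1 \<le> j} \<subseteq> diffset S1 S2"
    using assms(3,4) by (fastforce simp: diffset_def)
  ultimately show ?thesis using sep_rich_not_universal by blast
qed

end
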